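(* Let $\omega$ be a positive integer divisible by $7$. For online call control with $\omega$ frequencies in the cellular network, the algorithm CACO has asymptotic competitive ratio at most $7/3$, i.e. $$R^\infty_{\mathrm{CACO}}=\limsup_{n\to\infty}\ \max_{\sigma}\Big\{\frac{O(\sigma)}{\mathrm{CACO}(\sigma)} : O(\sigma)=n\Big\}\le \frac{7}{3}.$$
   Context: The cellular network is the infinite tiling of the plane by regular hexagons (cells); two cells are neighbors if they share an edge, so each cell has exactly 6 neighbors. Fix a proper 3-coloring of the cells with colors $R,G,B$ (neighboring cells get different colors). There are $\omega$ frequencies $\{1,\dots,\omega\}$. A request sequence $\sigma=(r_1,r_2,\dots)$ is a finite sequence of cells; $r_t$ is the cell where the $t$-th call request arrives. When a request arrives, an online algorithm, without knowledge of future requests, must immediately either reject it or accept it by assigning a frequency, subject to the constraint that two accepted calls in the same cell or in neighboring cells never get the same frequency; calls never terminate and assigned frequencies are never changed. $A(\sigma)$ denotes the number of requests accepted by algorithm $A$, and $O(\sigma)$ the maximum number of requests of $\sigma$ that can be simultaneously accepted by a feasible assignment (the optimal offline value). Algorithm CACO: partition the frequencies into $F_R=\{1,\dots,2\omega/7\}$, $F_G=\{2\omega/7+1,\dots,4\omega/7\}$, $F_B=\{4\omega/7+1,\dots,6\omega/7\}$, $F_S=\{6\omega/7+1,\dots,\omega\}$. When a request arrives at a cell $C$ of color $c$: if some frequency of $F_c$ is not yet used in $C$, assign the smallest such frequency; otherwise, if some frequency of $F_S$ is used neither in $C$ nor in any neighbor of $C$, assign the smallest such frequency; otherwise reject the request.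 *)

theory Defs
  imports "HOL-Analysis.Analysis"
begin

text \<open>The cell \<open>(i, j)\<close> is the regular hexagon of side length 1 centred at
  \<open>centre (i, j)\<close>, with corners in the directions of the sixth roots of unity. The
  centres form the triangular lattice of minimal distance \<open>sqrt 3\<close>, so these hexagons tile
  the plane.\<close>

type_synonym cell = "int \<times> int"

definition centre :: "cell \<Rightarrow> complex" where
  "centre C = Complex (3 / 2 * of_int (fst C)) (sqrt 3 * (of_int (snd C) + of_int (fst C) / 2))"

definition corner :: "cell \<Rightarrow> nat \<Rightarrow> complex" where
  "corner C k = centre C + cis (of_nat k * pi / 3)"

definition edges :: "cell \<Rightarrow> complex set set" where
  "edges C = {closed_segment (corner C k) (corner C (Suc k)) | k. k < 6}"

definition neighbours :: "cell \<Rightarrow> cell \<Rightarrow> bool" where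
  "neighbours C D \<longleftrightarrow> C \<noteq> D \<and> edges C \<inter> edges D \<noteq> {}"

text \<open>Doubled real parts and imaginary parts in units of \<open>sqrt 3 / 2\<close> of the corners.\<close>

definition grid :: "cell \<Rightarrow> nat \<Rightarrow> int \<times> int" where
  "grid C k = (3 * fst C + [2,1,-1,-2,-1,1,2] ! k, 2 * snd C + fst C + [0,1,1,0,-1,-1,0] ! k)"

lemma nat_less_7_cases: "k < 7 \<Longrightarrow> k = 0 \<or> k = 1 \<or> k = 2 \<or> k = 3 \<or> k = 4 \<or> k = 5 \<or> k = (6::nat)"
  by linarith

lemma corner_grid:
  assumes "k < 7"
  shows "corner C k = Complex (of_int (fst (grid C k)) / 2) (sqrt 3 / 2 * of_int (snd (grid C k)))"
proof -
  have a: "3 * pi / 3 = pi" "2 * pi / 3 = pi - pi / 3" "4 * pi / 3 = pi / 3 + pi" "6 * pi / 3 = 2 * pi"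
    "5 * pi / 3 = 2 * pi - pi / 3" by auto
  have s: "sin (2 * pi - pi / 3) = - (sqrt 3 / 2)" "cos (2 * pi - pi / 3) = 1 / 2"
    by (simp_all only: sin_diff cos_diff sin_two_pi cos_two_pi sin_60 cos_60; simp)+
  have t: "sin (pi / 3 + pi) = - (sqrt 3 / 2)" "cos (pi / 3 + pi) = - (1 / 2)"
    by (simp_all only: sin_periodic_pi cos_periodic_pi sin_60 cos_60)
  have u: "sin (pi - pi / 3) = (sqrt 3 / 2)" "cos (pi - pi / 3) = - (1 / 2)"
    by (simp_all only: sin_pi_minus cos_pi_minus sin_60 cos_60)
  have c: "corner C k = Complex (3 / 2 * of_int (fst C) + cos (of_nat k * pi / 3))
      (sqrt 3 * (of_int (snd C) + of_int (fst C) / 2) + sin (of_nat k * pi / 3))"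
    by (simp add: corner_def centre_def complex_eq_iff)
  from nat_less_7_cases[OF assms] show ?thesis
    unfolding c grid_def
    by (elim disjE; hypsubst; simp only: of_nat_numeral a s t u sin_pi cos_pi)
       (simp_all add: field_simps sin_60 cos_60)
qed

lemma corner_eq_iff:
  assumes "k < 7" "l < 7"
  shows "corner C k = corner D l \<longleftrightarrow> grid C k = grid D l"
  using assms by (auto simp: corner_grid prod_eq_iff)

lemma edges_meet_iff: "edges C \<inter> edges D \<noteq> {} \<longleftrightarrow>
  (\<exists>k\<in>{0,1,2,3,4,5}. \<exists>l\<in>{0,1,2,3,4,5}. {grid C k, grid C (Suc k)} = {grid D l, grid D (Suc l)})"
proof -
  have s: "{0,1,2,3,4,5} = {k. k < (6::nat)}" by auto
  have "edges C \<inter> edges D \<noteq> {} \<longleftrightarrow> (\<exists>k\<in>{k. k < 6}. \<exists>l\<in>{l. l < 6}.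
      closed_segment (corner C k) (corner C (Suc k)) = closed_segment (corner D l) (corner D (Suc l)))"
    unfolding edges_def by blast
  also have "\<dots> \<longleftrightarrow> (\<exists>k\<in>{k. k < 6}. \<exists>l\<in>{l. l < 6}. {grid C k, grid C (Suc k)} = {grid D l, grid D (Suc l)})"
    by (intro bex_cong refl) (simp add: closed_segment_eq doubleton_eq_iff corner_eq_iff)
  finally show ?thesis unfolding s .
qed

text \<open>Two cells share an edge exactly if they are adjacent in axial coordinates; in particular
  each cell has six neighbours.\<close>

lemma neighbours_iff:
  "neighbours (i, j) (i', j') \<longleftrightarrow>
     (i' - i, j' - j) \<in> {(1, 0), (0, 1), (-1, 0), (0, -1), (1, -1), (-1, 1)}"
proof
  assume "neighbours (i, j) (i', j')"
  then have n: "i \<noteq> i' \<or> j \<noteq> j'" and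
    "\<exists>k\<in>{0,1,2,3,4,5}. \<exists>l\<in>{0,1,2,3,4,5}. {grid (i,j) k, grid (i,j) (Suc k)} = {grid (i',j') l, grid (i',j') (Suc l)}"
    unfolding neighbours_def edges_meet_iff by auto
  from this(2) obtain k l where kl: "k \<in> {0,1,2,3,4,5}" "l \<in> {0,1,2,3,4,5}"
    "{grid (i,j) k, grid (i,j) (Suc k)} = {grid (i',j') l, grid (i',j') (Suc l)}" by blast
  have "fst (grid (i,j) k) + fst (grid (i,j) (Suc k)) = fst (grid (i',j') l) + fst (grid (i',j') (Suc l))"
    "snd (grid (i,j) k) + snd (grid (i,j) (Suc k)) = snd (grid (i',j') l) + snd (grid (i',j') (Suc l))"
    using kl(3) by (auto simp: doubleton_eq_iff)
  moreover have "fst (grid (a,b) m) + fst (grid (a,b) (Suc m)) \<le> 6 * a + 3 \<and>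
      6 * a - 3 \<le> fst (grid (a,b) m) + fst (grid (a,b) (Suc m)) \<and>
      snd (grid (a,b) m) + snd (grid (a,b) (Suc m)) \<le> 4 * b + 2 * a + 2 \<and>
      4 * b + 2 * a - 2 \<le> snd (grid (a,b) m) + snd (grid (a,b) (Suc m))"
    if "m \<in> {0,1,2,3,4,5}" for a b m
    using that unfolding grid_def by (elim insertE emptyE; hypsubst; simp add: eval_nat_numeral)
  note this[OF kl(1), of i j] this[OF kl(2), of i' j']
  ultimately have x: "i' - i \<le> 1" "- 1 \<le> i' - i"
    and y: "4 * j' + 2 * i' \<le> 4 * j + 2 * i + 4" "4 * j + 2 * i \<le> 4 * j' + 2 * i' + 4"
    by linarith+
  from x consider "i' - i = -1" | "i' - i = 0" | "i' - i = 1" by linarith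
  then show "(i' - i, j' - j) \<in> {(1, 0), (0, 1), (-1, 0), (0, -1), (1, -1), (-1, 1)}"
  proof cases
    case 1
    with y have "j' - j = 0 \<or> j' - j = 1" by linarith
    with 1 show ?thesis by auto
  next
    case 2
    with y n have "j' - j = -1 \<or> j' - j = 1" by linarith
    with 2 show ?thesis by auto
  next
    case 3
    with y have "j' - j = 0 \<or> j' - j = -1" by linarith
    with 3 show ?thesis by auto
  qed
next
  assume "(i' - i, j' - j) \<in> {(1, 0), (0, 1), (-1, 0), (0, -1), (1, -1), (-1, 1)}"
  then consider "i' = i + 1" "j' = j" | "i' = i" "j' = j + 1" | "i' = i - 1" "j' = j" | "i' = i" "j' = j - 1"
    | "i' = i + 1" "j' = j - 1" | "i' = i - 1" "j' = j + 1" by auto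
  then show "neighbours (i, j) (i', j')"
    unfolding neighbours_def edges_meet_iff grid_def
    by cases (simp_all add: doubleton_eq_iff eval_nat_numeral)
qed

datatype colour = Red | Green | Blue

definition proper_colouring :: "(cell \<Rightarrow> colour) \<Rightarrow> bool" where
  "proper_colouring col \<longleftrightarrow> (\<forall>C D. neighbours C D \<longrightarrow> col C \<noteq> col D)"

lemma ex_proper_colouring: "\<exists>col. proper_colouring col"
proof -
  let ?col = "\<lambda>(i, j). if (i - j) mod 3 = (0::int) then Red else if (i - j) mod 3 = 1 then Green else Blue"
  have "?col (i, j) \<noteq> ?col (i', j')" if "neighbours (i, j) (i', j')" for i j i' j'
  proof
    assume "?col (i, j) = ?col (i', j')" with that have "neighbours (i, j) (i', j')" and e: "?col (i, j) = ?col (i', j')" by auto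
    then have "(i' - i, j' - j) \<in> {(1, 0), (0, 1), (-1, 0), (0, -1), (1, -1), (-1, 1)}"
      by (simp only: neighbours_iff)
    then have "\<not> 3 dvd ((i' - j') - (i - j))" by (auto simp: algebra_simps)
    moreover have "(i - j) mod 3 = (i' - j') mod 3"
      using e by (auto split: if_splits; presburger)
    ultimately show False by (metis mod_eq_dvd_iff)
  qed
  then have "proper_colouring ?col" unfolding proper_colouring_def by fast
  then show ?thesis by (rule exI[of proper_colouring])
qed

text \<open>A call log lists the requests in order of arrival, each with the response it
  received: \<open>Some f\<close> if it was accepted with frequency \<open>f\<close>, \<open>None\<close> if it
  was rejected.\<close>

type_synonym call_log = "(cell \<times> nat option) list"

definition feasible :: "nat \<Rightarrow> call_log \<Rightarrow> bool" where
  "feasible \<omega> h \<longleftrightarrow>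
     (\<forall>C f. (C, Some f) \<in> set h \<longrightarrow> f \<in> {1..\<omega>}) \<and>
     (\<forall>s t C D f. s < t \<and> t < length h \<and> h ! s = (C, Some f) \<and> h ! t = (D, Some f)
        \<longrightarrow> C \<noteq> D \<and> \<not> neighbours C D)"

definition accepted :: "call_log \<Rightarrow> nat" where
  "accepted h = length (filter (\<lambda>(C, x). x \<noteq> None) h)"

definition opt :: "nat \<Rightarrow> cell list \<Rightarrow> nat" where
  "opt \<omega> \<sigma> = Max {accepted h | h. map fst h = \<sigma> \<and> feasible \<omega> h}"

text \<open>An online algorithm answers a request knowing only the log of the past and the cell of
  the current request.\<close>

type_synonym online_alg = "call_log \<Rightarrow> cell \<Rightarrow> nat option"

definition run :: "online_alg \<Rightarrow> cell list \<Rightarrow> call_log" where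
  "run A \<sigma> = foldl (\<lambda>h C. h @ [(C, A h C)]) [] \<sigma>"

text \<open>The quotient is taken in \<^typ>\<open>ereal\<close>, so that a sequence on which the algorithm accepts
  nothing while the optimum is positive has ratio \<open>\<infinity>\<close>.\<close>

definition asymptotic_ratio :: "nat \<Rightarrow> online_alg \<Rightarrow> ereal" where
  "asymptotic_ratio \<omega> A =
     limsup (\<lambda>n. SUP \<sigma>\<in>{\<sigma>. opt \<omega> \<sigma> = n}.
       ereal (real (opt \<omega> \<sigma>)) / ereal (real (accepted (run A \<sigma>))))"

fun own_freqs :: "nat \<Rightarrow> colour \<Rightarrow> nat set" where
  "own_freqs \<omega> Red = {1..2 * \<omega> div 7}"
| "own_freqs \<omega> Green = {2 * \<omega> div 7 + 1..4 * \<omega> div 7}"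
| "own_freqs \<omega> Blue = {4 * \<omega> div 7 + 1..6 * \<omega> div 7}"

definition shared_freqs :: "nat \<Rightarrow> nat set" where
  "shared_freqs \<omega> = {6 * \<omega> div 7 + 1..\<omega>}"

definition used :: "call_log \<Rightarrow> cell \<Rightarrow> nat set" where
  "used h C = {f. (C, Some f) \<in> set h}"

definition caco :: "nat \<Rightarrow> (cell \<Rightarrow> colour) \<Rightarrow> online_alg" where
  "caco \<omega> col h C =
     (let own = own_freqs \<omega> (col C) - used h C;
          shared = shared_freqs \<omega> - (used h C \<union> (\<Union>D\<in>{D. neighbours C D}. used h D))
      in if own \<noteq> {} then Some (Min own)
         else if shared \<noteq> {} then Some (Min shared)
         else None)"

lemma run_snoc: "run A (\<sigma> @ [C]) = run A \<sigma> @ [(C, A (run A \<sigma>) C)]"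
  by (simp add: run_def)

lemma neighbours_sym: "neighbours C D \<longleftrightarrow> neighbours D C"
  by (auto simp: neighbours_def)

lemma freq_bounds_mono: "2 * \<omega> div 7 \<le> 4 * \<omega> div 7" "4 * \<omega> div 7 \<le> 6 * \<omega> div (7::nat)"
  by (auto intro: div_le_mono)

lemma own_freqs_disjoint: "f \<in> own_freqs \<omega> c \<Longrightarrow> f \<in> own_freqs \<omega> d \<Longrightarrow> c = d"
  using freq_bounds_mono[of \<omega>] by (cases c; cases d; simp)

lemma own_freqs_not_shared: "f \<in> own_freqs \<omega> c \<Longrightarrow> f \<notin> shared_freqs \<omega>"
  using freq_bounds_mono[of \<omega>] by (cases c; simp add: shared_freqs_def)

lemma freqs_subset: "own_freqs \<omega> c \<subseteq> {1..\<omega>}" "shared_freqs \<omega> \<subseteq> {1..\<omega>}"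
  by (cases c; auto; linarith) (auto simp: shared_freqs_def)

lemma finite_freqs: "finite (own_freqs \<omega> c)" "finite (shared_freqs \<omega>)"
  using freqs_subset finite_subset by (metis finite_atLeastAtMost)+

lemma caco_SomeD:
  assumes "caco \<omega> col h C = Some f"
  shows "f \<in> own_freqs \<omega> (col C) - used h C \<or>
         f \<in> shared_freqs \<omega> - (used h C \<union> (\<Union>D\<in>{D. neighbours C D}. used h D))"
  using assms finite_freqs Min_in[of "own_freqs \<omega> (col C) - used h C"]
   Min_in[of "shared_freqs \<omega> - (used h C \<union> (\<Union>D\<in>{D. neighbours C D}. used h D))"]
  unfolding caco_def Let_def by (metis finite_Diff option.inject option.distinct(1))

lemma caco_inv:
  assumes "proper_colouring col"
  shows "feasible \<omega> (run (caco \<omega> col) \<sigma>) \<and>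
   (\<forall>(C, x) \<in> set (run (caco \<omega> col) \<sigma>). \<forall>f. x = Some f \<longrightarrow> f \<in> own_freqs \<omega> (col C) \<union> shared_freqs \<omega>)"
proof (induction \<sigma> rule: rev_induct)
  case Nil then show ?case by (simp add: run_def feasible_def)
next
  case (snoc C \<sigma>)
  let ?h = "run (caco \<omega> col) \<sigma>"
  have own: "f \<in> own_freqs \<omega> (col C) \<union> shared_freqs \<omega>" if "caco \<omega> col ?h C = Some f" for f
    using caco_SomeD[OF that] by auto
  have new: "D \<noteq> C \<and> \<not> neighbours D C" if "caco \<omega> col ?h C = Some f" "(D, Some f) \<in> set ?h" for f D
  proof -
    have D: "f \<in> own_freqs \<omega> (col D) \<union> shared_freqs \<omega>" "f \<in> used ?h D"
      using snoc.IH that(2) by (auto simp: used_def)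
    from caco_SomeD[OF that(1)] show ?thesis
    proof
      assume f: "f \<in> own_freqs \<omega> (col C) - used ?h C"
      then have "D \<noteq> C" using D by auto
      moreover have "col D = col C" using f D own_freqs_disjoint own_freqs_not_shared by blast
      then have "\<not> neighbours D C" using assms unfolding proper_colouring_def by blast
      ultimately show ?thesis ..
    next
      assume "f \<in> shared_freqs \<omega> - (used ?h C \<union> (\<Union>D\<in>{D. neighbours C D}. used ?h D))"
      then show ?thesis using D neighbours_sym[of C D] by blast
    qed
  qed
  have "feasible \<omega> (?h @ [(C, caco \<omega> col ?h C)])"
    unfolding feasible_def
  proof (intro conjI allI impI)
    fix D f assume "(D, Some f) \<in> set (?h @ [(C, caco \<omega> col ?h C)])"
    then show "f \<in> {1..\<omega>}" using own[of f] snoc.IH freqs_subset[of \<omega>] unfolding feasible_def by fastforce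
  next
    fix s t D E f
    assume a: "s < t \<and> t < length (?h @ [(C, caco \<omega> col ?h C)]) \<and>
      (?h @ [(C, caco \<omega> col ?h C)]) ! s = (D, Some f) \<and> (?h @ [(C, caco \<omega> col ?h C)]) ! t = (E, Some f)"
    have "D \<noteq> E \<and> \<not> neighbours D E"
    proof (cases "t < length ?h")
      case True
      with a have "?h ! s = (D, Some f)" "?h ! t = (E, Some f)" by (auto simp: nth_append)
      with a True snoc.IH show ?thesis unfolding feasible_def by blast
    next
      case False
      with a have "t = length ?h" by simp
      with a have "?h ! s = (D, Some f)" "s < length ?h" "E = C" "caco \<omega> col ?h C = Some f"
        by (auto simp: nth_append)
      with new[of f D] show ?thesis by (metis nth_mem)
    qed
    then show "D \<noteq> E" "\<not> neighbours D E" by auto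
  qed
  with own snoc.IH show ?case unfolding run_snoc by auto
qed

text \<open>CACO is a legitimate online algorithm: the assignment it produces is always feasible.\<close>

lemma caco_feasible: "proper_colouring col \<Longrightarrow> feasible \<omega> (run (caco \<omega> col) \<sigma>)"
  using caco_inv by blast

end

theory Submission
  imports Defs
begin

text \<open>Write \<open>\<omega> = 7k\<close>. For a cell \<open>C\<close> let \<open>o\<^sub>C\<close> be the number of calls accepted by the optimum, and
  \<open>a\<^sub>C\<close>, \<open>s\<^sub>C\<close> the numbers of own and shared frequencies that CACO uses in \<open>C\<close>. A cell needs help only
  if its excess \<open>x\<^sub>C = max 0 (3 o\<^sub>C - 14 k)\<close> is positive; then CACO has rejected a call in \<open>C\<close>, so that
  all \<open>k\<close> shared frequencies occur in \<open>C\<close> and its neighbours. Let every cell \<open>D\<close> pay \<open>s\<^sub>D x\<^sub>C\<close> to each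
  neighbour \<open>C\<close>. Since three mutually adjacent cells have \<open>o\<^sub>C + o\<^sub>D + o\<^sub>E \<le> 7k\<close>, no two adjacent cells
  have positive excess, at most three neighbours of a cell receive payments from it, and after the
  payments \<open>3 k o\<^sub>C \<le> 7 k (a\<^sub>C + s\<^sub>C)\<close> holds in every cell. Summing over all cells, the payments cancel.\<close>

section \<open>Call logs\<close>

lemma used_snoc:
  "used (h @ [(C, x)]) D = used h D \<union> (if D = C then set_option x else {})"
  by (auto simp: used_def)

lemma finite_used: "finite (used h C)"
proof -
  have "used h C \<subseteq> (the \<circ> snd) ` set h" by (force simp: used_def)
  then show ?thesis by (rule finite_subset) simp
qed

lemma used_outside: "C \<notin> fst ` set h \<Longrightarrow> used h C = {}"
  by (force simp: used_def)

lemma feasible_range: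
  assumes "feasible \<omega> h" "(C, Some f) \<in> set h"
  shows "f \<in> {1..\<omega>}"
  using conjunct1[OF assms(1)[unfolded feasible_def], rule_format, OF assms(2)] .

lemma used_subset:
  assumes "feasible \<omega> h"
  shows "used h C \<subseteq> {1..\<omega>}"
proof
  fix f assume "f \<in> used h C"
  then have "(C, Some f) \<in> set h" by (simp add: used_def)
  then show "f \<in> {1..\<omega>}" by (rule feasible_range[OF assms])
qed

lemma feasible_appendD:
  assumes "feasible \<omega> (h @ h')"
  shows "feasible \<omega> h"
  unfolding feasible_def
proof (intro conjI allI impI)
  fix C f
  assume "(C, Some f) \<in> set h"
  then have "(C, Some f) \<in> set (h @ h')" by simp
  then show "f \<in> {1..\<omega>}" by (rule feasible_range[OF assms])
next
  fix s t C D f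
  assume "s < t \<and> t < length h \<and> h ! s = (C, Some f) \<and> h ! t = (D, Some f)"
  then have "s < t \<and> t < length (h @ h') \<and> (h @ h') ! s = (C, Some f) \<and> (h @ h') ! t = (D, Some f)"
    by (simp add: nth_append)
  then have "C \<noteq> D \<and> \<not> neighbours C D" using assms unfolding feasible_def by blast
  then show "C \<noteq> D" "\<not> neighbours C D" by auto
qed

lemma feasible_snoc_fresh:
  assumes "feasible \<omega> (h @ [(C, Some f)])"
  shows "f \<notin> used h C"
proof
  assume "f \<in> used h C"
  then obtain s where "s < length h" "h ! s = (C, Some f)"
    by (auto simp: used_def in_set_conv_nth)
  then show False
    using assms unfolding feasible_def
    by (metis (no_types, lifting) length_append_singleton lessI nth_append nth_append_length)
qed

lemma used_disjoint:
  assumes "feasible \<omega> h" "neighbours C D"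
  shows "used h C \<inter> used h D = {}"
proof (rule ccontr)
  assume "used h C \<inter> used h D \<noteq> {}"
  then obtain f s t where st: "s < length h" "h ! s = (C, Some f)" "t < length h" "h ! t = (D, Some f)"
    by (auto simp: used_def in_set_conv_nth)
  have "s \<noteq> t" using st assms(2) by (auto simp: neighbours_def)
  then consider "s < t" | "t < s" by linarith
  then show False
    using st assms neighbours_sym[of C D] unfolding feasible_def by cases blast+
qed

text \<open>In a feasible log no frequency occurs twice in one cell, so each accepted call adds a
  new element to \<open>used h C\<close> for its cell. This turns both sides of the comparison into
  sums over cells.\<close>

lemma accepted_eq_sum_card_used:
  assumes "feasible \<omega> h" "finite S" "fst ` set h \<subseteq> S"
  shows "accepted h = (\<Sum>C\<in>S. card (used h C))"
  using assms
proof (induction h rule: rev_induct)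
  case Nil
  then show ?case by (simp add: accepted_def used_def)
next
  case (snoc p h)
  obtain C x where p: "p = (C, x)" by fastforce
  have IH: "accepted h = (\<Sum>C\<in>S. card (used h C))"
    using snoc feasible_appendD by auto
  have C: "C \<in> S" using snoc.prems p by auto
  show ?case
  proof (cases x)
    case None
    then have "used (h @ [p]) D = used h D" for D by (simp add: p used_snoc)
    then show ?thesis using IH None by (simp add: p accepted_def)
  next
    case (Some f)
    have "f \<notin> used h C"
      using feasible_snoc_fresh snoc.prems(1) p Some by blast
    then have "card (used (h @ [p]) D) = card (used h D) + (if D = C then 1 else 0)" for D
      by (simp add: p Some used_snoc finite_used)
    then show ?thesis
      using IH C \<open>finite S\<close> by (simp add: sum.distrib) (simp add: p Some accepted_def)
  qed
qed

text \<open>Applied to an optimal log: where CACO uses fewer frequencies than the optimum, it uses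
  fewer than there were requests, hence has rejected one.\<close>

lemma card_used_le_count: "card (used h C) \<le> count_list (map fst h) C"
proof (induction h rule: rev_induct)
  case Nil
  then show ?case by (simp add: used_def)
next
  case (snoc p h)
  obtain D x where p: "p = (D, x)" by fastforce
  show ?case
    using snoc by (cases x) (auto simp: p used_snoc finite_used card_insert_if le_Suc_eq)
qed

text \<open>The maximum ranges over a set that is bounded by the number of requests and nonempty,
  because rejecting every request is feasible.\<close>

lemma opt_attained:
  obtains h where "map fst h = \<sigma>" "feasible \<omega> h" "accepted h = opt \<omega> \<sigma>"
proof -
  let ?A = "{accepted h | h. map fst h = \<sigma> \<and> feasible \<omega> h}"
  have "accepted h \<le> length \<sigma>" if "map fst h = \<sigma>" for h
    using that by (auto simp: accepted_def)
  then have "finite ?A"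
    by (intro finite_subset[of ?A "{..length \<sigma>}"]) auto
  moreover have "map fst (map (\<lambda>C. (C, None :: nat option)) \<sigma>) = \<sigma>"
    by (simp add: comp_def)
  moreover have "feasible \<omega> (map (\<lambda>C. (C, None)) \<sigma>)"
    by (auto simp: feasible_def)
  ultimately have "opt \<omega> \<sigma> \<in> ?A"
    unfolding opt_def by (intro Max_in) blast+
  then show thesis using that by fastforce
qed

lemma map_fst_run: "map fst (run A \<sigma>) = \<sigma>"
  by (induction \<sigma> rule: rev_induct) (simp_all add: run_snoc, simp add: run_def)

section \<open>Frequencies used by CACO\<close>

lemma caco_cases:
  obtains (own) f where "caco \<omega> col h C = Some f" "f \<in> own_freqs \<omega> (col C)" "f \<notin> used h C"
  | (shared) f where "caco \<omega> col h C = Some f" "f \<in> shared_freqs \<omega>" "f \<notin> used h C"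
      "own_freqs \<omega> (col C) \<subseteq> used h C"
  | (rejected) "caco \<omega> col h C = None" "own_freqs \<omega> (col C) \<subseteq> used h C"
      "shared_freqs \<omega> \<subseteq> used h C \<union> (\<Union>D\<in>{D. neighbours C D}. used h D)"
proof (cases "own_freqs \<omega> (col C) - used h C = {}")
  case False
  moreover from False have "Min (own_freqs \<omega> (col C) - used h C) \<in> own_freqs \<omega> (col C) - used h C"
    by (intro Min_in) (simp_all add: finite_freqs)
  ultimately show ?thesis using own by (simp add: caco_def Let_def)
next
  case own_full: True
  let ?B = "shared_freqs \<omega> - (used h C \<union> (\<Union>D\<in>{D. neighbours C D}. used h D))"
  show ?thesis
  proof (cases "?B = {}")
    case True
    with own_full show ?thesis by (intro rejected) (auto simp: caco_def Let_def)
  next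
    case False
    then have "Min ?B \<in> ?B" by (intro Min_in) (simp_all add: finite_freqs)
    moreover have "caco \<omega> col h C = Some (Min ?B)"
      using own_full False by (auto simp: caco_def Let_def)
    ultimately show ?thesis using own_full by (intro shared[of "Min ?B"]) auto
  qed
qed

text \<open>A shared frequency is assigned only once the own ones are exhausted, and the sets of
  used frequencies only grow.\<close>

lemma caco_shared_imp_own_full:
  assumes "used (run (caco \<omega> col) \<sigma>) C \<inter> shared_freqs \<omega> \<noteq> {}"
  shows "own_freqs \<omega> (col C) \<subseteq> used (run (caco \<omega> col) \<sigma>) C"
  using assms
proof (induction \<sigma> rule: rev_induct)
  case Nil
  then show ?case by (simp add: run_def used_def)
next
  case (snoc D \<sigma>)
  let ?h = "run (caco \<omega> col) \<sigma>"
  show ?case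
    using snoc own_freqs_not_shared[of _ \<omega> "col D"]
    by (cases \<omega> col ?h D rule: caco_cases) (auto simp: run_snoc used_snoc split: if_splits)
qed

text \<open>Fewer frequencies than requests in \<open>C\<close> means that a request there was
  rejected. At that moment every own and shared frequency was blocked, and it stays blocked since
  calls never end.\<close>

lemma caco_rejected_imp_full:
  assumes "card (used (run (caco \<omega> col) \<sigma>) C) < count_list \<sigma> C"
  shows "own_freqs \<omega> (col C) \<subseteq> used (run (caco \<omega> col) \<sigma>) C \<and>
    shared_freqs \<omega> \<subseteq> used (run (caco \<omega> col) \<sigma>) C \<union>
      (\<Union>D\<in>{D. neighbours C D}. used (run (caco \<omega> col) \<sigma>) D)"
  using assms
proof (induction \<sigma> rule: rev_induct)
  case Nil
  then show ?case by simp
next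
  case (snoc D \<sigma>)
  let ?h = "run (caco \<omega> col) \<sigma>"
  let ?h' = "run (caco \<omega> col) (\<sigma> @ [D])"
  have mono: "used ?h E \<subseteq> used ?h' E" for E
    by (auto simp: run_snoc used_snoc)
  show ?case
  proof (cases "card (used ?h C) < count_list \<sigma> C")
    case True
    with snoc.IH mono show ?thesis by blast
  next
    case False
    \<comment> \<open>The deficit in \<open>C\<close> appears only now, so the last request came to
      \<open>C\<close> and received no new frequency.\<close>
    with snoc.prems have "D = C"
      using card_mono[OF finite_used mono[of C]] by (auto split: if_splits)
    moreover have "caco \<omega> col ?h C = None"
    proof (cases \<omega> col ?h C rule: caco_cases)
      case (own f)
      with False snoc.prems show ?thesis by (simp add: \<open>D = C\<close> run_snoc used_snoc finite_used)
    next
      case (shared f)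
      with False snoc.prems show ?thesis by (simp add: \<open>D = C\<close> run_snoc used_snoc finite_used)
    qed
    ultimately show ?thesis
      using mono by (cases \<omega> col ?h C rule: caco_cases) (simp_all, blast)
  qed
qed

lemma card_freqs:
  assumes "\<omega> = 7 * k"
  shows "card (own_freqs \<omega> c) = 2 * k" "card (shared_freqs \<omega>) = k"
proof -
  have "2 * \<omega> div 7 = 2 * k" "4 * \<omega> div 7 = 4 * k" "6 * \<omega> div 7 = 6 * k"
    using assms by simp_all
  then show "card (own_freqs \<omega> c) = 2 * k" "card (shared_freqs \<omega>) = k"
    using assms by (cases c; simp add: shared_freqs_def)+
qed

section \<open>The discharging argument\<close>

definition hexagon :: "cell \<Rightarrow> cell set" where
  "hexagon C = {D. neighbours C D}"

lemma hexagon_eq: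
  "hexagon (i, j) = {(i + 1, j), (i, j + 1), (i - 1, j + 1), (i - 1, j), (i, j - 1), (i + 1, j - 1)}"
  by (auto simp: hexagon_def neighbours_iff)

lemma finite_hexagon: "finite (hexagon C)"
  by (cases C) (simp add: hexagon_eq)

text \<open>The bracketing pairs cells that are consecutive around the ring, so each pair forms a
  triangle with the centre.\<close>

lemma sum_hexagon:
  fixes f :: "cell \<Rightarrow> 'a::comm_monoid_add"
  shows "sum f (hexagon (i, j)) =
    (f (i + 1, j) + f (i, j + 1)) + (f (i - 1, j + 1) + f (i - 1, j)) + (f (i, j - 1) + f (i + 1, j - 1))"
  by (simp add: hexagon_eq add.assoc)

lemma sum_hexagon_le:
  fixes f :: "cell \<Rightarrow> int"
  assumes "\<And>D E. neighbours C D \<Longrightarrow> neighbours C E \<Longrightarrow> neighbours D E \<Longrightarrow> f D + f E \<le> b"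
  shows "sum f (hexagon C) \<le> 3 * b"
proof -
  obtain i j where C: "C = (i, j)" by fastforce
  have "f (i + 1, j) + f (i, j + 1) \<le> b" "f (i - 1, j + 1) + f (i - 1, j) \<le> b"
    "f (i, j - 1) + f (i + 1, j - 1) \<le> b"
    by (rule assms; simp add: C neighbours_iff)+
  then show ?thesis unfolding C sum_hexagon by linarith
qed

text \<open>Extends an adjacent pair to a triangle, so that the bound on triangles also bounds
  pairs.\<close>

lemma common_neighbour:
  assumes "neighbours C D"
  obtains E where "neighbours C E" "neighbours D E"
proof -
  obtain i j where C: "C = (i, j)" by fastforce
  obtain d e where D: "D = (i + d, j + e)"
    by (metis diff_add_cancel add.commute surj_pair)
  have "(d, e) \<in> {(1, 0), (0, 1), (-1, 0), (0, -1), (1, -1), (-1, 1)}"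
    using assms by (simp add: C D neighbours_iff)
  \<comment> \<open>\<open>(- e, d + e)\<close> is \<open>(d, e)\<close> rotated by 60 degrees\<close>
  then have "neighbours C (i - e, j + d + e)" "neighbours D (i - e, j + d + e)"
    by (elim insertE; simp add: C D neighbours_iff)+
  then show thesis by (rule that)
qed

text \<open>Double counting of ordered adjacent pairs, by symmetry of \<open>neighbours\<close>.
  Vanishing outside \<open>S\<close> lets each sum over a ring be cut down to
  \<open>S\<close>.\<close>

lemma payments_cancel:
  fixes f g :: "cell \<Rightarrow> 'a::comm_semiring_0"
  assumes "finite S" "\<And>C. C \<notin> S \<Longrightarrow> f C = 0" "\<And>C. C \<notin> S \<Longrightarrow> g C = 0"
  shows "(\<Sum>C\<in>S. f C * sum g (hexagon C)) = (\<Sum>C\<in>S. g C * sum f (hexagon C))"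
proof -
  have "sum h (hexagon C) = (\<Sum>D\<in>S. if neighbours C D then h D else 0)"
    if "\<And>C. C \<notin> S \<Longrightarrow> h C = 0" for C and h :: "cell \<Rightarrow> 'a"
  proof -
    have "sum h (hexagon C) = sum h (S \<inter> hexagon C)"
      using that finite_hexagon by (intro sum.mono_neutral_right) auto
    then show ?thesis
      using assms(1) by (simp add: sum.inter_restrict hexagon_def)
  qed
  note inner = this
  have "(\<Sum>C\<in>S. f C * sum g (hexagon C)) = (\<Sum>C\<in>S. \<Sum>D\<in>S. f C * (if neighbours C D then g D else 0))"
    by (simp add: inner assms(3) sum_distrib_left)
  also have "\<dots> = (\<Sum>D\<in>S. \<Sum>C\<in>S. f C * (if neighbours C D then g D else 0))"
    by (rule sum.swap)
  also have "\<dots> = (\<Sum>D\<in>S. \<Sum>C\<in>S. g D * (if neighbours D C then f C else 0))"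
  proof (intro sum.cong refl)
    fix C D
    show "f C * (if neighbours C D then g D else 0) = g D * (if neighbours D C then f C else 0)"
      using neighbours_sym[of C D] by (simp add: mult.commute)
  qed
  also have "\<dots> = (\<Sum>D\<in>S. g D * sum f (hexagon D))"
    by (simp add: inner assms(2) sum_distrib_left)
  finally show ?thesis .
qed

text \<open>Here \<open>p\<close> counts the calls of the optimum, \<open>a\<close> and
  \<open>s\<close> the own and shared frequencies of CACO; \<open>full\<close> is the consequence of
  a rejection. Integers are used so that differences are not truncated.\<close>

lemma discharging:
  fixes p a s :: "cell \<Rightarrow> int" and k :: int
  assumes "k > 0" "finite S"
    and outside: "\<And>C. C \<notin> S \<Longrightarrow> p C = 0" "\<And>C. C \<notin> S \<Longrightarrow> s C = 0"
    and nonneg: "\<And>C. 0 \<le> p C" "\<And>C. 0 \<le> s C"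
    and triangle: "\<And>C D E. neighbours C D \<Longrightarrow> neighbours C E \<Longrightarrow> neighbours D E \<Longrightarrow>
      p C + p D + p E \<le> 7 * k"
    and s_le: "\<And>C. s C \<le> k"
    and a_le: "\<And>C. a C \<le> 2 * k"
    and a_eq: "\<And>C. 0 < s C \<Longrightarrow> a C = 2 * k"
    and full: "\<And>C. a C + s C < p C \<Longrightarrow> a C = 2 * k \<and> k \<le> s C + sum s (hexagon C)"
  shows "3 * sum p S \<le> 7 * (\<Sum>C\<in>S. a C + s C)"
proof -
  \<comment> \<open>The threshold is 7 * 2k: with all 2k own frequencies in use, a cell without
    excess meets the ratio 7/3 on its own.\<close>
  define x where "x C = max 0 (3 * p C - 14 * k)" for C
  have pair: "p C + p D \<le> 7 * k" if "neighbours C D" for C D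
  proof -
    obtain E where "neighbours C E" "neighbours D E"
      by (rule common_neighbour[OF \<open>neighbours C D\<close>])
    then show ?thesis using triangle[of C D E] that nonneg(1)[of E] by linarith
  qed
  have p_le: "p C \<le> 7 * k" for C
  proof -
    obtain i j where C: "C = (i, j)" by fastforce
    have "neighbours C (i + 1, j)" by (simp add: C neighbours_iff)
    then show ?thesis using pair[of C "(i + 1, j)"] nonneg(1)[of "(i + 1, j)"] by linarith
  qed
  \<comment> \<open>The local inequality, scaled by \<open>k\<close>: outgoing payments stand on the
    left, incoming ones on the right.\<close>
  have cell: "k * (3 * p C) + s C * sum x (hexagon C) \<le> k * (7 * (a C + s C)) + x C * sum s (hexagon C)" for C
  proof (cases "x C > 0")
    case True
    then have xC: "x C = 3 * p C - 14 * k" by (simp add: x_def)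
    have "x D = 0" if "neighbours C D" for D
      using pair[OF that] True \<open>k > 0\<close> by (simp add: x_def)
    then have x0: "sum x (hexagon C) = 0"
      by (auto intro!: sum.neutral simp: hexagon_def)
    \<comment> \<open>CACO has at most 3k calls in \<open>C\<close>, while positive excess means p C
      > 14k/3.\<close>
    have "a C + s C < p C"
      using True xC a_le[of C] s_le[of C] \<open>k > 0\<close> by linarith
    note full = full[OF this]
    \<comment> \<open>Split \<open>k * x C\<close>: the part \<open>(k - s C) * x C\<close> is
      covered by incoming payments, the part \<open>s C * x C\<close> by 7k for each shared
      frequency in \<open>C\<close>, as \<open>x C\<close> is at most 21k - 14k.\<close>
    have "(k - s C) * x C \<le> sum s (hexagon C) * x C"
      using full True by (intro mult_right_mono) auto
    moreover have "s C * x C \<le> s C * (7 * k)"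
      using p_le[of C] xC nonneg(2) by (intro mult_left_mono) auto
    moreover have "k * (3 * p C) = k * (x C + 14 * k)" by (simp add: xC)
    ultimately show ?thesis using full by (simp add: x0 algebra_simps)
  next
    case False
    then have xC: "x C = 0" and p14: "3 * p C \<le> 14 * k" by (auto simp: x_def)
    show ?thesis
    proof (cases "s C > 0")
      case False
      then have "s C = 0" using nonneg(2)[of C] by simp
      \<comment> \<open>Either \<open>p C <= a C\<close>, or a call was rejected; then
        \<open>a C = 2 * k\<close> and the absence of excess suffices.\<close>
      moreover have "3 * p C \<le> 7 * a C"
        using full[of C] p14 \<open>s C = 0\<close> nonneg(1)[of C] by linarith
      ultimately show ?thesis using \<open>k > 0\<close> xC by simp
    next
      case True
      \<comment> \<open>Of two adjacent neighbours of \<open>C\<close> at most one, say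
        \<open>D\<close>, has positive excess; then p D <= 7k - p C yields x D <= 7k - 3 p C. Three
        such pairs make up the ring.\<close>
      let ?b = "max 0 (7 * k - 3 * p C)"
      have "sum x (hexagon C) \<le> 3 * ?b"
        using triangle pair nonneg(1) \<open>k > 0\<close>
        by (intro sum_hexagon_le) (smt (verit, best) x_def)
      then have le: "s C * sum x (hexagon C) \<le> s C * (3 * ?b)"
        using True by (intro mult_left_mono) auto
      \<comment> \<open>When ?b = 7k - 3 p C, the slack in the target inequality is exactly (k - s
        C)(14k - 3 p C) + 6 s C p C.\<close>
      have "0 \<le> (k - s C) * (14 * k - 3 * p C)" "0 \<le> s C * p C" "0 \<le> k * s C"
        using s_le[of C] p14 nonneg \<open>k > 0\<close> by simp_all
      moreover have "k * (3 * p C) \<le> k * (14 * k)"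
        using p14 \<open>k > 0\<close> by (intro mult_left_mono) auto
      ultimately have "k * (3 * p C) + s C * (3 * ?b) \<le> k * (7 * (2 * k + s C))"
        by (auto simp: max_def algebra_simps)
      then show ?thesis using le a_eq[OF True] xC by simp
    qed
  qed
  have "k * (3 * sum p S) + (\<Sum>C\<in>S. s C * sum x (hexagon C)) \<le>
      k * (7 * (\<Sum>C\<in>S. a C + s C)) + (\<Sum>C\<in>S. x C * sum s (hexagon C))"
    using sum_mono[of S, OF cell] by (simp add: sum.distrib flip: sum_distrib_left)
  moreover have "(\<Sum>C\<in>S. s C * sum x (hexagon C)) = (\<Sum>C\<in>S. x C * sum s (hexagon C))"
    using assms(1,2) outside by (intro payments_cancel) (auto simp: x_def)
  ultimately show ?thesis using \<open>k > 0\<close> by simp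
qed

text \<open>The discharging bound is applied to an optimal log and to the run of CACO over the
  requested cells. There is no additive constant, so the asymptotic bound follows at once.\<close>

lemma caco_competitive:
  assumes "\<omega> > 0" "7 dvd \<omega>" "proper_colouring col"
  shows "3 * opt \<omega> \<sigma> \<le> 7 * accepted (run (caco \<omega> col) \<sigma>)"
proof -
  obtain k where k: "\<omega> = 7 * k" "k > 0" using assms(1,2) by auto
  obtain h where h: "map fst h = \<sigma>" "feasible \<omega> h" "accepted h = opt \<omega> \<sigma>"
    using opt_attained by blast
  let ?g = "run (caco \<omega> col) \<sigma>"
  let ?S = "set \<sigma>"
  define p where "p C = card (used h C)" for C
  define a where "a C = card (used ?g C \<inter> own_freqs \<omega> (col C))" for C
  define s where "s C = card (used ?g C \<inter> shared_freqs \<omega>)" for C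
  have g: "feasible \<omega> ?g" "\<And>C. used ?g C \<subseteq> own_freqs \<omega> (col C) \<union> shared_freqs \<omega>"
    using caco_inv[OF assms(3), of \<omega> \<sigma>] by (auto simp: used_def)
  have card_g: "card (used ?g C) = a C + s C" for C
  proof -
    have "used ?g C = (used ?g C \<inter> own_freqs \<omega> (col C)) \<union> (used ?g C \<inter> shared_freqs \<omega>)"
      using g(2)[of C] by blast
    moreover have "card \<dots> = a C + s C"
      unfolding a_def s_def using own_freqs_not_shared
      by (intro card_Un_disjoint) (auto simp: finite_used)
    ultimately show ?thesis by simp
  qed
  have a_full: "a C = 2 * k" if "own_freqs \<omega> (col C) \<subseteq> used ?g C" for C
    using that card_freqs(1)[OF k(1), of "col C"] by (simp add: a_def Int_absorb1)
  have fst_h: "fst ` set h = ?S" using h(1) by (metis list.set_map)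
  have fst_g: "fst ` set ?g = ?S" using map_fst_run by (metis list.set_map)
  have "3 * (\<Sum>C\<in>?S. int (p C)) \<le> 7 * (\<Sum>C\<in>?S. int (a C) + int (s C))"
  proof (rule discharging[where k = "int k"])
    fix C
    show "int (p C) = 0" if "C \<notin> ?S" using that by (simp add: p_def used_outside fst_h)
    show "int (s C) = 0" if "C \<notin> ?S" using that by (simp add: s_def used_outside fst_g)
    show "int (s C) \<le> int k"
      using card_mono[OF finite_freqs(2), of "used ?g C \<inter> shared_freqs \<omega>" \<omega>] card_freqs(2)[OF k(1)]
      by (simp add: s_def)
    show "int (a C) \<le> 2 * int k"
      using card_mono[OF finite_freqs(1), of "used ?g C \<inter> own_freqs \<omega> (col C)" \<omega> "col C"]
        card_freqs(1)[OF k(1), of "col C"]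
      by (simp add: a_def)
    show "int (a C) = 2 * int k" if "0 < int (s C)"
    proof -
      have "used ?g C \<inter> shared_freqs \<omega> \<noteq> {}" using that by (auto simp: s_def)
      then show ?thesis using a_full caco_shared_imp_own_full by simp
    qed
    show "int (a C) = 2 * int k \<and> int k \<le> int (s C) + (\<Sum>D\<in>hexagon C. int (s D))"
      if "int (a C) + int (s C) < int (p C)"
    proof
      have "card (used ?g C) < count_list \<sigma> C"
        using that card_used_le_count[of h C] h(1) by (simp add: card_g p_def)
      note full = caco_rejected_imp_full[OF this]
      then show "int (a C) = 2 * int k" using a_full by simp
      have "shared_freqs \<omega> \<subseteq> (\<Union>D\<in>insert C (hexagon C). used ?g D \<inter> shared_freqs \<omega>)"
        using full by (auto simp: hexagon_def)
      then have "card (shared_freqs \<omega>) \<le> card (\<Union>D\<in>insert C (hexagon C). used ?g D \<inter> shared_freqs \<omega>)"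
        by (intro card_mono) (simp_all add: finite_used finite_hexagon)
      also have "\<dots> \<le> (\<Sum>D\<in>insert C (hexagon C). s D)"
        unfolding s_def by (intro card_UN_le) (simp add: finite_hexagon)
      also have "\<dots> = s C + sum s (hexagon C)"
      proof -
        have "C \<notin> hexagon C" by (simp add: hexagon_def neighbours_def)
        then show ?thesis by (simp add: finite_hexagon)
      qed
      finally show "int k \<le> int (s C) + (\<Sum>D\<in>hexagon C. int (s D))"
        using card_freqs(2)[OF k(1)] by (metis of_nat_add of_nat_le_iff of_nat_sum)
    qed
    fix D E assume CDE: "neighbours C D" "neighbours C E" "neighbours D E"
    note disj = used_disjoint[OF h(2) CDE(1)] used_disjoint[OF h(2) CDE(2)] used_disjoint[OF h(2) CDE(3)]
    \<comment> \<open>Mutually adjacent cells use pairwise disjoint sets of frequencies, all inside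
      the 7k available ones.\<close>
    have "p C + p D + p E = card (used h C \<union> used h D \<union> used h E)"
      using disj by (simp add: p_def card_Un_disjoint finite_used Int_Un_distrib2)
    also have "\<dots> \<le> card {1..\<omega>}"
      using used_subset[OF h(2)] by (intro card_mono) auto
    finally show "int (p C) + int (p D) + int (p E) \<le> 7 * int k" by (simp add: k)
  qed (use k in simp_all)
  then have "3 * (\<Sum>C\<in>?S. p C) \<le> 7 * (\<Sum>C\<in>?S. a C + s C)"
    by (metis (mono_tags, lifting) of_nat_add of_nat_le_iff of_nat_mult of_nat_numeral of_nat_sum sum.cong)
  moreover have "opt \<omega> \<sigma> = (\<Sum>C\<in>?S. p C)"
    using accepted_eq_sum_card_used[OF h(2)] h(3) fst_h by (simp add: p_def)
  moreover have "accepted ?g = (\<Sum>C\<in>?S. a C + s C)"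
    using accepted_eq_sum_card_used[OF g(1)] fst_g by (simp flip: card_g)
  ultimately show ?thesis by simp
qed

theorem theorem1:
  fixes \<omega> :: nat and col :: "cell \<Rightarrow> colour"
  assumes "\<omega> > 0" and "7 dvd \<omega>"
    and "proper_colouring col"
  shows "asymptotic_ratio \<omega> (caco \<omega> col) \<le> 7 / 3"
proof -
  have ratio: "ereal (real (opt \<omega> \<sigma>)) / ereal (real (accepted (run (caco \<omega> col) \<sigma>))) \<le> 7 / 3"
    if "opt \<omega> \<sigma> > 0" for \<sigma>
  proof -
    let ?r = "accepted (run (caco \<omega> col) \<sigma>)"
    have le: "3 * opt \<omega> \<sigma> \<le> 7 * ?r" by (rule caco_competitive[OF assms])
    \<comment> \<open>A positive optimum forces CACO to accept something, which excludes an infinite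
      quotient.\<close>
    then have "0 < real ?r" using that by (cases ?r) auto
    moreover have "3 * real (opt \<omega> \<sigma>) \<le> 7 * real ?r" using le by linarith
    ultimately have "real (opt \<omega> \<sigma>) / real ?r \<le> 7 / 3" by (simp add: field_simps)
    moreover have "(7 / 3 :: ereal) = ereal (7 / 3)"
      by (metis ereal_divide numeral_eq_ereal zero_neq_numeral)
    ultimately show ?thesis using \<open>0 < real ?r\<close> by simp
  qed
  show ?thesis
    unfolding asymptotic_ratio_def
  proof (intro Limsup_bounded eventually_mono[OF eventually_gt_at_top[of 0]] SUP_least ratio)
    fix n \<sigma>
    assume "0 < n" "\<sigma> \<in> {\<sigma>. opt \<omega> \<sigma> = n}"
    then show "0 < opt \<omega> \<sigma>" by simp
  qed
qed

end
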